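(* Let $|q|<1$, $x\in\mathbb{C}$, and $k\ge 1$ an integer. Then \[ \frac{1}{(q^2;q^2)_\infty} \sum_{n\geq 0} q^{(2k+1)n^2} \big(V_n(x)+V_{n-1}(x)\big) =\sum_{n_k\geq n_{k-1}\geq \cdots \geq n_1\geq 0} \frac{q^{2(n_1^2+\cdots +n_k^2)}\prod_{j=1}^{n_1} (1+2xq^{2j-1}+q^{4j-2})}{(q^2;q^2)_{n_k-n_{k-1}}(q^2;q^2)_{n_{k-1}-n_{k-2}}\cdots (q^2;q^2)_{n_2-n_1}(q^2;q^2)_{2n_1}}. \]
   Context: $(a;q)_n=\prod_{i=0}^{n-1}(1-aq^i)$, $(a;q)_\infty=\prod_{i\ge0}(1-aq^i)$. $V_n(x)$ is the Chebyshev polynomial of the third kind: $V_0=1$, $V_1=2x-1$, $V_n=2xV_{n-1}-V_{n-2}$ ($n>1$), and $V_n=0$ for $n<0$. For $k=1$ the sum is over $n_1\ge0$ only, with denominator $(q^2;q^2)_{2n_1}$. *)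

theory Defs
  imports "HOL-Analysis.Analysis"
begin

definition qpoch :: "complex \<Rightarrow> complex \<Rightarrow> nat \<Rightarrow> complex" where
  "qpoch a q n = (\<Prod>i<n. 1 - a * q ^ i)"

definition qpoch_inf :: "complex \<Rightarrow> complex \<Rightarrow> complex" where
  "qpoch_inf a q = (\<Prod>i. 1 - a * q ^ i)"

fun cheb_V_nat :: "nat \<Rightarrow> complex \<Rightarrow> complex" where
  "cheb_V_nat 0 x = 1"
| "cheb_V_nat (Suc 0) x = 2 * x - 1"
| "cheb_V_nat (Suc (Suc n)) x = 2 * x * cheb_V_nat (Suc n) x - cheb_V_nat n x"

definition cheb_V :: "int \<Rightarrow> complex \<Rightarrow> complex" where
  "cheb_V n x = (if n < 0 then 0 else cheb_V_nat (nat n) x)"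

text \<open>A multi-index \<open>n\<^sub>k \<ge> \<dots> \<ge> n\<^sub>1 \<ge> 0\<close> is a function on \<open>{1..k}\<close>; the extensional function space
  makes each tuple occur exactly once.\<close>

definition multi_indices :: "nat \<Rightarrow> (nat \<Rightarrow> nat) set" where
  "multi_indices k = {n \<in> {1..k} \<rightarrow>\<^sub>E UNIV. \<forall>j\<in>{1..<k}. n j \<le> n (j + 1)}"

definition multisum_term :: "nat \<Rightarrow> complex \<Rightarrow> complex \<Rightarrow> (nat \<Rightarrow> nat) \<Rightarrow> complex" where
  "multisum_term k q x n =
     q ^ (2 * (\<Sum>j=1..k. (n j)\<^sup>2)) *
     (\<Prod>j=1..n 1. 1 + 2 * x * q ^ (2 * j - 1) + q ^ (4 * j - 2)) /
     ((\<Prod>j=1..<k. qpoch (q\<^sup>2) (q\<^sup>2) (n (j + 1) - n j)) * qpoch (q\<^sup>2) (q\<^sup>2) (2 * n 1))"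

end

theory Submission imports Defs begin

text \<open>
  The Bailey chain with base \<open>Q = q\<^sup>2\<close>. For \<open>2x = z + 1/z\<close> one has \<open>V\<^sub>r(x) + V\<^sub>r\<^sub>-\<^sub>1(x) = z\<^sup>r + z\<^sup>-\<^sup>r\<close> when
  \<open>r \<ge> 1\<close>, so the finite Jacobi triple product says that \<open>\<alpha>\<^sub>r = q^(r\<^sup>2) (V\<^sub>r(x) + V\<^sub>r\<^sub>-\<^sub>1(x))\<close> and
  \<open>\<beta>\<^sub>n = (\<Prod>j=1..n. 1 + 2xq^(2j-1) + q^(4j-2)) / (Q;Q)\<^sub>2\<^sub>n\<close> form a Bailey pair. The \<open>q\<close>-Vandermonde
  sum shows that \<open>\<alpha>'\<^sub>r = Q^(r\<^sup>2) \<alpha>\<^sub>r\<close>, \<open>\<beta>'\<^sub>n = \<Sum>\<^sub>s Q^(s\<^sup>2) \<beta>\<^sub>s / (Q;Q)\<^sub>n\<^sub>-\<^sub>s\<close> is again a Bailey pair;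
  \<open>k - 1\<close> such steps produce the inner sums over \<open>n\<^sub>1, \<dots>, n\<^sub>k\<^sub>-\<^sub>1\<close>. After one more step both
  expressions for \<open>\<beta>\<^sub>N\<close> converge as \<open>N \<rightarrow> \<infinity>\<close> by Tannery's theorem, and the two limits differ from the
  two sides of the identity by the common factor \<open>1 / (Q;Q)\<^sub>\<infinity>\<close>.
\<close>

section \<open>Reciprocal q-factorials and the q-Vandermonde sum\<close>

definition inv_qpoch :: "complex \<Rightarrow> nat \<Rightarrow> complex" where
  "inv_qpoch q n = inverse (qpoch q q n)"

lemma qpoch_nonzero:
  assumes "norm q < 1"
  shows "qpoch q q n \<noteq> 0"
proof -
  have "q ^ Suc i \<noteq> 1" for i
    using assms power_less_one_iff[of "norm q" "Suc i"]
    by (metis norm_ge_zero norm_one norm_power order_less_irrefl zero_less_Suc)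
  then show ?thesis
    by (auto simp: qpoch_def)
qed

lemma inv_qpoch_0 [simp]: "inv_qpoch q 0 = 1"
  by (simp add: inv_qpoch_def qpoch_def)

lemma inv_qpoch_step:
  assumes "norm q < 1"
  shows "(1 - q ^ Suc n) * inv_qpoch q (Suc n) = inv_qpoch q n"
  using qpoch_nonzero[OF assms, of "Suc n"]
  by (simp add: inv_qpoch_def qpoch_def field_simps)

lemma one_minus_power_nonzero:
  assumes "norm (q :: complex) < 1"
  shows "1 - q ^ Suc n \<noteq> 0"
  using qpoch_nonzero[OF assms, of "Suc n"] by (simp add: qpoch_def)

text \<open>Induction on \<open>N\<close> for all \<open>m\<close> at once. Multiplying by
  \<open>1 - q ^ Suc N\<close> and splitting that factor as
  \<open>(1 - q ^ (Suc N - j)) + q ^ (Suc N - j) * (1 - q ^ j)\<close> cancels one reciprocal factor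
  in each part, which leaves the sums for \<open>(N, m)\<close> and
  \<open>(N, m + 1)\<close>.\<close>

lemma q_vandermonde:
  assumes q: "norm q < 1"
  shows "(\<Sum>j\<le>N. q ^ (j\<^sup>2 + m * j) * inv_qpoch q (N - j) * inv_qpoch q j * inv_qpoch q (j + m))
           = inv_qpoch q N * inv_qpoch q (N + m)"
proof (induction N arbitrary: m)
  case 0
  show ?case by simp
next
  case (Suc N)
  define t where "t j = q ^ (j\<^sup>2 + m * j) * inv_qpoch q (Suc N - j) * inv_qpoch q j * inv_qpoch q (j + m)" for j
  have split: "(1 - q ^ Suc N) * t j = (1 - q ^ (Suc N - j)) * t j + q ^ (Suc N - j) * (1 - q ^ j) * t j"
    if "j \<le> Suc N" for j
  proof -
    have "q ^ Suc N = q ^ (Suc N - j) * q ^ j"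
      using that by (simp flip: power_add)
    then show ?thesis
      by (simp add: algebra_simps)
  qed
  have first: "(1 - q ^ (Suc N - j)) * t j
      = q ^ (j\<^sup>2 + m * j) * inv_qpoch q (N - j) * inv_qpoch q j * inv_qpoch q (j + m)" if "j \<le> N" for j
    using inv_qpoch_step[OF q, of "N - j"] that
    by (simp add: t_def Suc_diff_le mult_ac flip: power_Suc)
  have second: "q ^ (Suc N - Suc j) * (1 - q ^ Suc j) * t (Suc j)
      = q ^ (Suc N + m) * (q ^ (j\<^sup>2 + Suc m * j) * inv_qpoch q (N - j) * inv_qpoch q j * inv_qpoch q (j + Suc m))"
    if "j \<le> N" for j
  proof -
    have "q ^ (Suc N - Suc j) * (1 - q ^ Suc j) * t (Suc j)
      = q ^ (N - j) * q ^ ((Suc j)\<^sup>2 + m * Suc j) * inv_qpoch q (N - j) * ((1 - q ^ Suc j) * inv_qpoch q (Suc j))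
          * inv_qpoch q (j + Suc m)"
      by (simp add: t_def mult_ac)
    also have "q ^ (N - j) * q ^ ((Suc j)\<^sup>2 + m * Suc j) = q ^ (Suc N + m) * q ^ (j\<^sup>2 + Suc m * j)"
    proof -
      have "N - j + ((Suc j)\<^sup>2 + m * Suc j) = Suc N + m + (j\<^sup>2 + Suc m * j)"
        using that by (simp add: power2_eq_square)
      then show ?thesis by (simp only: flip: power_add)
    qed
    also note inv_qpoch_step[OF q]
    finally show ?thesis
      by (simp only: mult.assoc)
  qed
  have "(1 - q ^ Suc N) * (\<Sum>j\<le>Suc N. t j)
      = (\<Sum>j\<le>Suc N. (1 - q ^ (Suc N - j)) * t j) + (\<Sum>j\<le>Suc N. q ^ (Suc N - j) * (1 - q ^ j) * t j)"
    unfolding sum_distrib_left sum.distrib[symmetric] by (intro sum.cong) (use split in auto)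
  \<comment> \<open>The factor \<open>1 - q ^ 0\<close> kills the term \<open>j = Suc N\<close> here
    and the term \<open>j = 0\<close> in the other sum, whose index is then shifted by one.\<close>
  also have "(\<Sum>j\<le>Suc N. (1 - q ^ (Suc N - j)) * t j) = inv_qpoch q N * inv_qpoch q (N + m)"
    unfolding Suc.IH[of m, symmetric] sum.atMost_Suc
    by (subst sum.cong[OF refl first]) auto
  also have "(\<Sum>j\<le>Suc N. q ^ (Suc N - j) * (1 - q ^ j) * t j)
      = q ^ (Suc N + m) * (inv_qpoch q N * inv_qpoch q (N + Suc m))"
    unfolding Suc.IH[of "Suc m", symmetric] sum_distrib_left sum.atMost_Suc_shift
    by (subst sum.cong[OF refl second]) auto
  also have "inv_qpoch q N * inv_qpoch q (N + m) + q ^ (Suc N + m) * (inv_qpoch q N * inv_qpoch q (N + Suc m))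
      = inv_qpoch q N * inv_qpoch q (Suc N + m)"
    by (simp add: inv_qpoch_step[OF q, of "N + m", symmetric] algebra_simps)
  also have "\<dots> = (1 - q ^ Suc N) * (inv_qpoch q (Suc N) * inv_qpoch q (Suc N + m))"
    by (simp only: inv_qpoch_step[OF q, of N, symmetric] mult.assoc)
  finally show ?case
    using one_minus_power_nonzero[OF q, of N] by (simp add: t_def)
qed

text \<open>Bailey pairs relative to \<open>a = 1\<close>.\<close>

definition bailey_pair :: "complex \<Rightarrow> (nat \<Rightarrow> complex) \<Rightarrow> (nat \<Rightarrow> complex) \<Rightarrow> bool" where
  "bailey_pair q \<alpha> \<beta> \<longleftrightarrow> (\<forall>n. \<beta> n = (\<Sum>r\<le>n. \<alpha> r * (inv_qpoch q (n - r) * inv_qpoch q (n + r))))"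

text \<open>Insert the sum for \<open>\<beta> s\<close> and interchange. With
  \<open>s = r + j\<close> the exponent is \<open>s^2 = r^2 + (j^2 + 2rj)\<close>, so the inner sum
  is \<open>q_vandermonde\<close> for \<open>N = n - r\<close> and \<open>m = 2r\<close>.\<close>

lemma bailey_pair_step:
  assumes q: "norm q < 1" and bp: "bailey_pair q \<alpha> \<beta>"
  shows "bailey_pair q (\<lambda>r. q ^ r\<^sup>2 * \<alpha> r) (\<lambda>n. \<Sum>s\<le>n. q ^ s\<^sup>2 * \<beta> s * inv_qpoch q (n - s))"
  unfolding bailey_pair_def
proof
  fix n
  define g where "g r s = q ^ s\<^sup>2 * inv_qpoch q (n - s) * (inv_qpoch q (s - r) * inv_qpoch q (s + r))" for r s
  have inner: "(\<Sum>s=r..n. g r s) = q ^ r\<^sup>2 * (inv_qpoch q (n - r) * inv_qpoch q (n + r))" if "r \<le> n" for r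
  proof -
    have "(\<Sum>s=r..n. g r s) = (\<Sum>j\<le>n - r. g r (r + j))"
      using that by (intro sum.reindex_bij_witness[of _ "\<lambda>j. r + j" "\<lambda>s. s - r"]) auto
    also have "\<dots> = (\<Sum>j\<le>n - r. q ^ r\<^sup>2 * (q ^ (j\<^sup>2 + (2 * r) * j) * inv_qpoch q (n - r - j) * inv_qpoch q j
                                       * inv_qpoch q (j + 2 * r)))"
    proof (intro sum.cong refl)
      fix j
      have e: "q ^ (r + j)\<^sup>2 = q ^ r\<^sup>2 * q ^ (j\<^sup>2 + (2 * r) * j)"
        unfolding power_add[symmetric] by (rule arg_cong[of _ _ "power q"]) (simp add: power2_eq_square algebra_simps)
      have s: "r + j + r = j + 2 * r" by simp
      show "g r (r + j) = q ^ r\<^sup>2 * (q ^ (j\<^sup>2 + (2 * r) * j) * inv_qpoch q (n - r - j) * inv_qpoch q j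
                                       * inv_qpoch q (j + 2 * r))"
        unfolding g_def e s by (simp add: mult_ac)
    qed
    also have "\<dots> = q ^ r\<^sup>2 * (inv_qpoch q (n - r) * inv_qpoch q (n - r + 2 * r))"
      by (simp only: sum_distrib_left[symmetric] q_vandermonde[OF q])
    also have "n - r + 2 * r = n + r" using that by simp
    finally show ?thesis .
  qed
  have "(\<Sum>s\<le>n. q ^ s\<^sup>2 * \<beta> s * inv_qpoch q (n - s)) = (\<Sum>s\<le>n. \<Sum>r\<le>s. \<alpha> r * g r s)"
    using bp by (simp add: bailey_pair_def g_def sum_distrib_left sum_distrib_right mult_ac)
  also have "\<dots> = (\<Sum>r\<le>n. \<Sum>s=r..n. \<alpha> r * g r s)"
    unfolding sum.Sigma[OF finite_atMost ballI[OF finite_atMost]]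
      sum.Sigma[OF finite_atMost ballI[OF finite_atLeastAtMost]]
    by (intro sum.reindex_bij_witness[of _ "\<lambda>(r, s). (s, r)" "\<lambda>(s, r). (r, s)"]) auto
  also have "\<dots> = (\<Sum>r\<le>n. q ^ r\<^sup>2 * \<alpha> r * (inv_qpoch q (n - r) * inv_qpoch q (n + r)))"
    by (intro sum.cong refl) (simp add: inner mult_ac flip: sum_distrib_left)
  finally show "(\<Sum>s\<le>n. q ^ s\<^sup>2 * \<beta> s * inv_qpoch q (n - s))
      = (\<Sum>r\<le>n. q ^ r\<^sup>2 * \<alpha> r * (inv_qpoch q (n - r) * inv_qpoch q (n + r)))" .
qed

section \<open>The Bailey pair built from Chebyshev polynomials\<close>

definition cheb_pair :: "complex \<Rightarrow> nat \<Rightarrow> complex" where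
  "cheb_pair x n = cheb_V (int n) x + cheb_V (int n - 1) x"

lemma cheb_pair_0: "cheb_pair x 0 = 1"
  by (simp add: cheb_pair_def cheb_V_def)

lemma cheb_pair_Suc: "cheb_pair x (Suc n) = cheb_V_nat (Suc n) x + cheb_V_nat n x"
  by (simp add: cheb_pair_def cheb_V_def nat_add_distrib)

lemma cheb_pair_1: "cheb_pair x (Suc 0) = 2 * x"
  by (simp add: cheb_pair_Suc)

text \<open>From index 1 on the values are \<open>2 T_n(x)\<close>, but at index 0 the value is 1
  instead of 2. Hence the three-term recurrence fails here and starts only with
  \<open>cheb_pair_rec\<close>.\<close>

lemma cheb_pair_2: "cheb_pair x (Suc (Suc 0)) = 2 * x * cheb_pair x (Suc 0) - 2"
  by (simp add: cheb_pair_Suc algebra_simps)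

lemma cheb_pair_rec:
  "cheb_pair x (Suc (Suc (Suc n))) = 2 * x * cheb_pair x (Suc (Suc n)) - cheb_pair x (Suc n)"
  by (simp add: cheb_pair_Suc algebra_simps)

text \<open>The triple product is proved without \<open>z\<close>, by induction on \<open>n\<close> from the three-term recurrence of
  \<open>V\<^sub>r + V\<^sub>r\<^sub>-\<^sub>1\<close>; the coefficient \<open>2\<close> of \<open>w 1\<close> stands for the missing terms with negative index.\<close>

lemma sum_mult_cheb_pair:
  "2 * x * (\<Sum>r<m + 2. w r * cheb_pair x r)
     = 2 * w 1 + (\<Sum>r<m + 2. w r * cheb_pair x (Suc r)) + (\<Sum>r<m. w (r + 2) * cheb_pair x (Suc r))"
proof (induction m)
  case 0
  show ?case
    by (simp add: numeral_2_eq_2 cheb_pair_0 cheb_pair_1 cheb_pair_2 algebra_simps)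
next
  case (Suc m)
  then show ?case
    by (simp add: cheb_pair_rec algebra_simps)
qed

text \<open>Both sides obey the same first-order recurrence in \<open>n\<close> and agree at
  \<open>n = 0\<close>. For the sum, \<open>sum_mult_cheb_pair\<close> turns multiplication by
  \<open>2x\<close> into shifts of \<open>r\<close>, and the coefficients of each
  \<open>cheb_pair x r\<close> are compared.\<close>

lemma bailey_pair_cheb:
  assumes q: "norm q < 1"
  shows "bailey_pair (q\<^sup>2) (\<lambda>r. q ^ r\<^sup>2 * cheb_pair x r)
     (\<lambda>n. (\<Prod>j=1..n. 1 + 2 * x * q ^ (2 * j - 1) + q ^ (4 * j - 2)) * inv_qpoch (q\<^sup>2) (2 * n))"
  unfolding bailey_pair_def
proof
  define Q where "Q = q\<^sup>2"
  have Q: "norm Q < 1"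
    using q by (simp add: Q_def norm_power power_less_one_iff)
  \<comment> \<open>The explicit 0 matters: for \<open>r > n\<close> the truncated
    \<open>n - r\<close> is 0 and the product of reciprocals would not vanish.\<close>
  define e where "e n r = (if r \<le> n then inv_qpoch Q (n - r) * inv_qpoch Q (n + r) else 0)" for n r
  define E where "E n = (\<Sum>r\<le>n. q ^ r\<^sup>2 * e n r * cheb_pair x r)" for n
  define c where "c n = (1 - Q ^ (2 * n + 1)) * (1 - Q ^ (2 * n + 2))" for n
  \<comment> \<open>Coefficient of \<open>cheb_pair x 0\<close>: the neighbours \<open>r = 1\<close>
    and \<open>r = -1\<close> contribute equally, hence the factor 2. The inner \<open>q\<close> is
    \<open>q ^ r^2\<close> at \<open>r = 1\<close>.\<close>
  have coeff0: "c n * e (Suc n) 0 = (1 + Q ^ (2 * n + 1)) * e n 0 + q ^ (2 * n + 1) * (2 * (q * e n 1))" for n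
  proof -
    have e0: "e n 0 = (1 - Q ^ Suc n)\<^sup>2 * e (Suc n) 0"
      by (simp add: e_def inv_qpoch_step[OF Q, of n, symmetric] power2_eq_square mult_ac)
    \<comment> \<open>For \<open>n = 0\<close> both sides vanish, the right one through
      \<open>1 - Q ^ 0\<close>.\<close>
    have e1: "e n 1 = (1 - Q ^ n) * (1 - Q ^ Suc n) * e (Suc n) 0"
      using inv_qpoch_step[OF Q, of "n - 1"] inv_qpoch_step[OF Q, of n]
      by (cases n) (auto simp: e_def mult_ac)
    have pw: "Q ^ (2 * n + 1) = Q * Q ^ n * Q ^ n" "Q ^ (2 * n + 2) = Q * Q * Q ^ n * Q ^ n"
      "Q ^ Suc n = Q * Q ^ n"
      by (simp_all add: power_mult_distrib power_mult power2_eq_square mult.commute[of 2] flip: mult_2)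
    have q1: "q ^ (2 * n + 1) * (2 * (q * e n 1)) = 2 * Q ^ Suc n * e n 1"
      by (simp add: Q_def power_mult power2_eq_square mult_ac power_mult_distrib)
    show ?thesis
      unfolding q1 unfolding e0 e1 c_def pw power2_eq_square by (simp add: algebra_simps)
  qed
  have coeff: "c n * (q ^ (Suc r)\<^sup>2 * e (Suc n) (Suc r))
      = (1 + Q ^ (2 * n + 1)) * (q ^ (Suc r)\<^sup>2 * e n (Suc r))
        + q ^ (2 * n + 1) * (q ^ r\<^sup>2 * e n r + q ^ (r + 2)\<^sup>2 * e n (r + 2))" if rn: "r \<le> n" for n r
  proof -
    obtain t where n: "n = r + t"
      using le_Suc_ex[OF rn] by blast
    \<comment> \<open>Each value of \<open>e\<close> below becomes \<open>R * S\<close> times a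
      polynomial in powers of \<open>Q\<close> and \<open>b\<close>, so the claim reduces to a
      polynomial identity.\<close>
    define R where "R = inv_qpoch Q t"
    define S where "S = inv_qpoch Q (n + r + 2)"
    define b where "b = Q ^ (n + r + 1)"
    have S1: "inv_qpoch Q (n + r + 1) = (1 - Q * b) * S"
      using inv_qpoch_step[OF Q, of "n + r + 1"] by (simp add: S_def b_def)
    have S0: "inv_qpoch Q (n + r) = (1 - b) * ((1 - Q * b) * S)"
      using inv_qpoch_step[OF Q, of "n + r"] unfolding S1[symmetric] by (simp add: b_def)
    have a: "e (Suc n) (Suc r) = R * S"
      by (simp add: e_def n R_def S_def)
    have d: "e n r = R * ((1 - b) * ((1 - Q * b) * S))"
      using S0 by (simp add: e_def n R_def)
    \<comment> \<open>Completing squares: \<open>r^2 + 2n + 1 = (r+1)^2 + 2(n-r)\<close> and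
      \<open>(r+2)^2 + 2n + 1 = (r+1)^2 + 2(n+r+2)\<close>, so \<open>q ^ (r+1)^2\<close> is common
      to all terms.\<close>
    have p0: "q ^ (2 * n + 1) * q ^ r\<^sup>2 = q ^ (Suc r)\<^sup>2 * Q ^ t"
      unfolding Q_def power_mult[symmetric] power_add[symmetric]
      by (rule arg_cong[of _ _ "power q"]) (simp add: n power2_eq_square algebra_simps)
    have p2: "q ^ (2 * n + 1) * q ^ (r + 2)\<^sup>2 = q ^ (Suc r)\<^sup>2 * (Q * b)"
      unfolding Q_def b_def power_mult[symmetric] power_Suc[symmetric] power_add[symmetric]
      by (rule arg_cong[of _ _ "power q"]) (simp add: n power2_eq_square algebra_simps)
    have pc: "Q ^ (2 * n + 1) = Q ^ t * b"
      unfolding b_def power_add[symmetric] by (rule arg_cong[of _ _ "power Q"]) (simp add: n)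
    have pc': "Q ^ (2 * n + 2) = Q ^ t * b * Q"
      unfolding pc[symmetric] by simp
    have "c n * (R * S) = (1 + Q ^ (2 * n + 1)) * e n (Suc r) + Q ^ t * e n r + Q * b * e n (r + 2)"
    proof (cases t)
      case 0
      then have "e n (Suc r) = 0" "e n (r + 2) = 0"
        by (simp_all add: e_def n)
      then show ?thesis
        unfolding c_def pc pc' d by (simp add: 0 algebra_simps)
    next
      case (Suc u)
      have e1: "e n (Suc r) = (1 - Q ^ t) * R * ((1 - Q * b) * S)"
        using inv_qpoch_step[OF Q, of u] S1 by (simp add: e_def n Suc R_def)
      \<comment> \<open>For \<open>u = 0\<close> both sides vanish, since then
        \<open>r + 2 > n\<close>.\<close>
      have e2: "e n (r + 2) = (1 - Q ^ u) * ((1 - Q ^ t) * R) * S"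
        using inv_qpoch_step[OF Q, of u] inv_qpoch_step[OF Q, of "u - 1"]
        by (cases u) (auto simp: e_def n Suc R_def S_def)
      show ?thesis
        unfolding c_def pc pc' d e1 e2 by (simp add: Suc algebra_simps)
    qed
    then have "q ^ (Suc r)\<^sup>2 * (c n * (R * S)) = (1 + Q ^ (2 * n + 1)) * (q ^ (Suc r)\<^sup>2 * e n (Suc r))
        + q ^ (Suc r)\<^sup>2 * Q ^ t * e n r + q ^ (Suc r)\<^sup>2 * (Q * b) * e n (r + 2)"
      by (simp add: algebra_simps)
    then show ?thesis
      unfolding p0[symmetric] p2[symmetric] a by (simp add: algebra_simps)
  qed
  have E_rec: "c n * E (Suc n) = (1 + 2 * x * q ^ (2 * n + 1) + Q ^ (2 * n + 1)) * E n" for n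
  proof -
    define w where "w r = q ^ r\<^sup>2 * e n r" for r
    have w0: "w r = 0" if "r > n" for r
      using that by (simp add: w_def e_def)
    have E_w: "E n = (\<Sum>r<n + 2. w r * cheb_pair x r)"
      using w0[of "Suc n"] by (simp add: E_def w_def lessThan_Suc_atMost)
    have E_w': "E n = w 0 + (\<Sum>r\<le>n. w (Suc r) * cheb_pair x (Suc r))"
      unfolding E_w by (simp add: lessThan_Suc_atMost sum.atMost_Suc_shift cheb_pair_0 del: sum.atMost_Suc)
    have "2 * x * E n = 2 * w 1 + (\<Sum>r<n + 2. w r * cheb_pair x (Suc r))
        + (\<Sum>r<n. w (r + 2) * cheb_pair x (Suc r))"
      unfolding E_w by (rule sum_mult_cheb_pair)
    \<comment> \<open>Both ranges become \<open>r \<le> n\<close>: the first sum loses the zero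
      \<open>w (n + 1)\<close>, the second gains the zero \<open>w (n + 2)\<close>.\<close>
    also have "\<dots> = 2 * w 1 + (\<Sum>r\<le>n. (w r + w (r + 2)) * cheb_pair x (Suc r))"
      using w0[of "Suc n"] w0[of "n + 2"]
      by (simp add: lessThan_Suc_atMost[symmetric] sum.distrib algebra_simps)
    finally have xE: "2 * x * E n = \<dots>" .
    have "c n * E (Suc n) = c n * e (Suc n) 0
        + (\<Sum>r\<le>n. c n * (q ^ (Suc r)\<^sup>2 * e (Suc n) (Suc r)) * cheb_pair x (Suc r))"
      unfolding E_def sum.atMost_Suc_shift
      by (simp add: cheb_pair_0 sum_distrib_left algebra_simps)
    also have "\<dots> = ((1 + Q ^ (2 * n + 1)) * w 0 + q ^ (2 * n + 1) * (2 * w 1))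
        + (\<Sum>r\<le>n. ((1 + Q ^ (2 * n + 1)) * w (Suc r) + q ^ (2 * n + 1) * (w r + w (r + 2))) * cheb_pair x (Suc r))"
      by (intro arg_cong2[where f = "(+)"] sum.cong refl)
         (use coeff0[of n] coeff[of _ n] in \<open>simp_all add: w_def\<close>)
    also have "\<dots> = (1 + Q ^ (2 * n + 1)) * E n + q ^ (2 * n + 1) * (2 * x * E n)"
      unfolding xE unfolding E_w'
      by (simp add: sum.distrib sum_distrib_left algebra_simps)
    finally show ?thesis
      by (simp add: algebra_simps)
  qed
  fix n
  have "(\<Prod>j=1..n. 1 + 2 * x * q ^ (2 * j - 1) + q ^ (4 * j - 2)) * inv_qpoch Q (2 * n) = E n"
  proof (induction n)
    case 0
    show ?case by (simp add: E_def e_def cheb_pair_0)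
  next
    case (Suc n)
    have c: "c n * inv_qpoch Q (2 * Suc n) = inv_qpoch Q (2 * n)"
      using inv_qpoch_step[OF Q, of "2 * n"] inv_qpoch_step[OF Q, of "2 * n + 1"]
      by (simp add: c_def mult.assoc)
    have c0: "c n \<noteq> 0"
      using one_minus_power_nonzero[OF Q, of "2 * n"] one_minus_power_nonzero[OF Q, of "2 * n + 1"]
      by (simp add: c_def)
    have f: "q ^ (4 * Suc n - 2) = Q ^ (2 * n + 1)" "q ^ (2 * Suc n - 1) = q ^ (2 * n + 1)"
      by (simp_all add: Q_def flip: power_mult power_Suc)
    have pr: "(\<Prod>j=1..Suc n. 1 + 2 * x * q ^ (2 * j - 1) + q ^ (4 * j - 2))
        = (\<Prod>j=1..n. 1 + 2 * x * q ^ (2 * j - 1) + q ^ (4 * j - 2))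
          * (1 + 2 * x * q ^ (2 * Suc n - 1) + q ^ (4 * Suc n - 2))"
      by simp
    have "c n * E (Suc n) = (1 + 2 * x * q ^ (2 * n + 1) + Q ^ (2 * n + 1)) *
       ((\<Prod>j=1..n. 1 + 2 * x * q ^ (2 * j - 1) + q ^ (4 * j - 2)) * (c n * inv_qpoch Q (2 * Suc n)))"
      unfolding E_rec c Suc.IH ..
    also have "\<dots> = c n * ((\<Prod>j=1..Suc n. 1 + 2 * x * q ^ (2 * j - 1) + q ^ (4 * j - 2)) * inv_qpoch Q (2 * Suc n))"
      unfolding pr f by (simp only: mult_ac)
    finally show ?case
      using c0 by simp
  qed
  then show "(\<Prod>j=1..n. 1 + 2 * x * q ^ (2 * j - 1) + q ^ (4 * j - 2)) * inv_qpoch (q\<^sup>2) (2 * n)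
      = (\<Sum>r\<le>n. q ^ r\<^sup>2 * cheb_pair x r * (inv_qpoch (q\<^sup>2) (n - r) * inv_qpoch (q\<^sup>2) (n + r)))"
    by (simp add: E_def e_def Q_def mult_ac)
qed

section \<open>Infinite products, uniform bounds and the limit of a Bailey pair\<close>

lemma convergent_prod_qpoch:
  assumes "norm (q :: complex) < 1"
  shows "convergent_prod (\<lambda>i. 1 - q * q ^ i)"
proof -
  have "summable (\<lambda>i. norm q * norm q ^ i)"
    using assms by (intro summable_mult summable_geometric) auto
  then show ?thesis
    by (intro abs_convergent_prod_imp_convergent_prod summable_imp_abs_convergent_prod)
       (simp add: norm_mult norm_power)
qed

lemma qpoch_inf_nonzero:
  assumes "norm q < 1"
  shows "qpoch_inf q q \<noteq> 0"
  unfolding qpoch_inf_def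
  using one_minus_power_nonzero[OF assms]
  by (intro prodinf_nonzero convergent_prod_qpoch assms) simp

lemma inv_qpoch_tendsto:
  assumes "norm q < 1"
  shows "inv_qpoch q \<longlonglongrightarrow> inverse (qpoch_inf q q)"
proof -
  \<comment> \<open>Partial products of \<open>convergent_prod\<close> include the index
    \<open>n\<close>, hence the shift by one.\<close>
  have "(\<lambda>n. qpoch q q (Suc n)) \<longlonglongrightarrow> qpoch_inf q q"
    using convergent_prod_LIMSEQ[OF convergent_prod_qpoch[OF assms]]
    by (simp add: qpoch_def qpoch_inf_def lessThan_Suc_atMost)
  then have "qpoch q q \<longlonglongrightarrow> qpoch_inf q q"
    by (rule LIMSEQ_imp_Suc)
  then show ?thesis
    unfolding inv_qpoch_def by (intro tendsto_inverse qpoch_inf_nonzero assms)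
qed

lemma inv_qpoch_bounded:
  assumes "norm q < 1"
  obtains C where "C \<ge> 1" "\<And>n. norm (inv_qpoch q n) \<le> C"
proof -
  have "Bseq (inv_qpoch q)"
    using inv_qpoch_tendsto[OF assms] by (intro convergent_imp_Bseq) (auto simp: convergent_def)
  then obtain K where "\<And>n. norm (inv_qpoch q n) \<le> K"
    by (auto simp: Bseq_def)
  then show ?thesis
    by (intro that[of "max 1 K"]) (auto simp: le_max_iff_disj)
qed

text \<open>Since \<open>2j - 1\<close> and \<open>4j - 2\<close> are at least \<open>j\<close>,
  each factor has norm at most \<open>1 + c |q|^j \<le> exp (c |q|^j)\<close> with
  \<open>c = 2|x| + 1\<close>, and the exponents are bounded by a geometric series.\<close>

lemma quadratic_prod_bounded:
  fixes q x :: complex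
  assumes q: "norm q < 1"
  obtains P where "P \<ge> 0" "\<And>n. norm (\<Prod>j=1..n. 1 + 2 * x * q ^ (2 * j - 1) + q ^ (4 * j - 2)) \<le> P"
proof
  define c where "c = 2 * norm x + 1"
  have c: "c \<ge> 0" by (simp add: c_def)
  show "exp (c / (1 - norm q)) \<ge> 0" by simp
  fix n
  have step: "norm (1 + 2 * x * q ^ (2 * j - 1) + q ^ (4 * j - 2)) \<le> exp (c * norm q ^ j)" if "j \<ge> 1" for j
  proof -
    have "norm (1 + 2 * x * q ^ (2 * j - 1) + q ^ (4 * j - 2))
        \<le> 1 + 2 * norm x * norm q ^ (2 * j - 1) + norm q ^ (4 * j - 2)"
      by (rule norm_triangle_le add_mono)+ (auto simp: norm_mult norm_power)
    also have "\<dots> \<le> 1 + 2 * norm x * norm q ^ j + norm q ^ j"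
      using q that by (intro add_mono mult_left_mono power_decreasing) auto
    also have "\<dots> = 1 + c * norm q ^ j"
      by (simp add: c_def algebra_simps)
    also have "\<dots> \<le> exp (c * norm q ^ j)"
      by (rule exp_ge_add_one_self)
    finally show ?thesis .
  qed
  have "norm (\<Prod>j=1..n. 1 + 2 * x * q ^ (2 * j - 1) + q ^ (4 * j - 2)) \<le> (\<Prod>j=1..n. exp (c * norm q ^ j))"
    unfolding prod_norm[symmetric] by (intro prod_mono) (use step in auto)
  also have "\<dots> = exp (c * (\<Sum>j=1..n. norm q ^ j))"
    by (simp add: exp_sum sum_distrib_left)
  also have "\<dots> \<le> exp (c / (1 - norm q))"
  proof -
    have "(\<Sum>j=1..n. norm q ^ j) \<le> (\<Sum>j. norm q ^ j)"
      using q by (intro sum_le_suminf summable_geometric) auto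
    also have "\<dots> = 1 / (1 - norm q)"
      using q by (simp add: suminf_geometric)
    finally show ?thesis
      using mult_left_mono[OF _ c] by fastforce
  qed
  finally show "norm (\<Prod>j=1..n. 1 + 2 * x * q ^ (2 * j - 1) + q ^ (4 * j - 2)) \<le> exp (c / (1 - norm q))" .
qed

text \<open>Tannery's theorem after the growing range is moved into the summand, which is set to 0
  for \<open>r > N\<close>; the majorant is \<open>norm (c r) * C\<close>.\<close>

lemma tendsto_sum_atMost_mult:
  fixes c :: "nat \<Rightarrow> complex"
  assumes c: "summable (\<lambda>r. norm (c r))"
    and lim: "\<And>r. (\<lambda>N. w r N) \<longlonglongrightarrow> L"
    and bound: "\<And>r N. norm (w r N) \<le> C"
  shows "(\<lambda>N. \<Sum>r\<le>N. c r * w r N) \<longlonglongrightarrow> (\<Sum>r. c r) * L"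
proof -
  define a where "a r N = (if r \<le> N then c r * w r N else 0)" for r N
  have C: "C \<ge> 0"
    using bound[of 0 0] norm_ge_zero order_trans by blast
  have lim_a: "(a r \<longlongrightarrow> c r * L) sequentially" for r
  proof (rule Lim_transform_eventually)
    show "(\<lambda>N. c r * w r N) \<longlonglongrightarrow> c r * L"
      by (intro tendsto_intros lim)
    show "\<forall>\<^sub>F N in sequentially. c r * w r N = a r N"
      using eventually_ge_at_top[of r] by eventually_elim (simp add: a_def)
  qed
  have bound_a: "norm (a r N) \<le> norm (c r) * C" for r N
    using C by (auto simp: a_def norm_mult intro: mult_left_mono bound)
  have "((\<lambda>N. \<Sum>r. a r N) \<longlongrightarrow> (\<Sum>r. c r * L)) sequentially"
    by (rule tannerys_theorem[OF lim_a, where M = "\<lambda>r. norm (c r) * C", THEN conjunct2, THEN conjunct2])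
       (simp_all add: bound_a case_prod_unfold summable_mult2 c)
  moreover have "(\<Sum>r. a r N) = (\<Sum>r\<le>N. c r * w r N)" for N
    by (subst suminf_finite[of "{..N}"]) (auto simp: a_def)
  moreover have "(\<Sum>r. c r * L) = (\<Sum>r. c r) * L"
    using summable_norm_cancel[OF c] by (simp add: suminf_mult2)
  ultimately show ?thesis by simp
qed

text \<open>After one more chain step let the index tend to infinity. The \<alpha> side carries two
  reciprocals with limit \<open>L\<close>, the \<beta> side only one; cancelling one
  \<open>L\<close> leaves the prefactor.\<close>

lemma bailey_pair_limit:
  assumes q: "norm q < 1" and bp: "bailey_pair q \<alpha> \<beta>"
    and \<alpha>: "summable (\<lambda>r. norm (q ^ r\<^sup>2 * \<alpha> r))" and \<beta>: "summable (\<lambda>s. norm (q ^ s\<^sup>2 * \<beta> s))"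
  shows "1 / qpoch_inf q q * (\<Sum>r. q ^ r\<^sup>2 * \<alpha> r) = (\<Sum>s. q ^ s\<^sup>2 * \<beta> s)"
proof -
  define L where "L = inverse (qpoch_inf q q)"
  have L: "L \<noteq> 0"
    using qpoch_inf_nonzero[OF q] by (simp add: L_def)
  obtain C where C: "C \<ge> 1" "\<And>n. norm (inv_qpoch q n) \<le> C"
    using inv_qpoch_bounded[OF q] by blast
  have inv_qpoch_minus: "(\<lambda>N. inv_qpoch q (N - r)) \<longlonglongrightarrow> L" for r
    unfolding L_def by (rule LIMSEQ_offset[where k = r]) (simp add: inv_qpoch_tendsto[OF q])
  have inv_qpoch_plus: "(\<lambda>N. inv_qpoch q (N + r)) \<longlonglongrightarrow> L" for r
    unfolding L_def by (intro LIMSEQ_ignore_initial_segment inv_qpoch_tendsto q)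
  have "(\<lambda>N. \<Sum>r\<le>N. q ^ r\<^sup>2 * \<alpha> r * (inv_qpoch q (N - r) * inv_qpoch q (N + r))) \<longlonglongrightarrow> (\<Sum>r. q ^ r\<^sup>2 * \<alpha> r) * (L * L)"
    by (rule tendsto_sum_atMost_mult[where C = "C * C"])
       (use \<alpha> C in \<open>auto simp: norm_mult intro!: tendsto_mult inv_qpoch_minus inv_qpoch_plus mult_mono\<close>)
  moreover have "(\<lambda>N. \<Sum>s\<le>N. q ^ s\<^sup>2 * \<beta> s * inv_qpoch q (N - s)) \<longlonglongrightarrow> (\<Sum>s. q ^ s\<^sup>2 * \<beta> s) * L"
    by (rule tendsto_sum_atMost_mult[where C = C]) (use C in \<open>auto intro: \<beta> inv_qpoch_minus\<close>)
  ultimately have "(\<Sum>r. q ^ r\<^sup>2 * \<alpha> r) * (L * L) = (\<Sum>s. q ^ s\<^sup>2 * \<beta> s) * L"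
    using bailey_pair_step[OF q bp] by (simp add: bailey_pair_def LIMSEQ_unique)
  then show ?thesis
    using L by (simp add: L_def field_simps)
qed

section \<open>Iteration of the chain and growth of the Chebyshev coefficients\<close>

primrec iter_beta :: "complex \<Rightarrow> complex \<Rightarrow> nat \<Rightarrow> nat \<Rightarrow> complex" where
  "iter_beta q x 0 = (\<lambda>n. (\<Prod>j=1..n. 1 + 2 * x * q ^ (2 * j - 1) + q ^ (4 * j - 2)) * inv_qpoch (q\<^sup>2) (2 * n))"
| "iter_beta q x (Suc m) = (\<lambda>n. \<Sum>s\<le>n. (q\<^sup>2) ^ s\<^sup>2 * iter_beta q x m s * inv_qpoch (q\<^sup>2) (n - s))"

text \<open>The factor \<open>d\<close> keeps the left side in the shape that
  \<open>bailey_pair_step\<close> produces.\<close>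

lemma iter_alpha_step: "(q\<^sup>2) ^ r\<^sup>2 * (q ^ ((2 * m + 1) * r\<^sup>2) * d) = q ^ ((2 * Suc m + 1) * r\<^sup>2) * (d :: complex)"
  unfolding power_mult[symmetric] mult.assoc[symmetric] power_add[symmetric]
  by (rule arg_cong[where f = "\<lambda>e. q ^ e * d"]) (simp add: distrib_right)

lemma bailey_pair_iter:
  assumes q: "norm q < 1"
  shows "bailey_pair (q\<^sup>2) (\<lambda>r. q ^ ((2 * m + 1) * r\<^sup>2) * cheb_pair x r) (iter_beta q x m)"
proof (induction m)
  case 0
  show ?case using bailey_pair_cheb[OF q] by simp
next
  case (Suc m)
  have Q: "norm (q\<^sup>2) < 1"
    using q by (simp add: norm_power power_less_one_iff)
  show ?case
    using bailey_pair_step[OF Q Suc.IH] unfolding iter_alpha_step by simp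
qed

text \<open>The base \<open>M = 2|x| + 1\<close> closes the recurrence:
  \<open>2|x| M^(m+2) + M^(m+1) \<le> M^(m+3)\<close> because \<open>M \<ge> 1\<close>.\<close>

lemma norm_cheb_pair_le: "norm (cheb_pair x n) \<le> 2 * (2 * norm x + 1) ^ n"
proof (induction n rule: less_induct)
  case (less n)
  define M where "M = 2 * norm x + 1"
  have M: "M \<ge> 1" by (simp add: M_def)
  consider "n = 0" | "n = 1" | "n = 2" | m where "n = Suc (Suc (Suc m))"
    by (metis One_nat_def Suc_1 not0_implies_Suc)
  then show ?case
  proof cases
    case 4
    have "norm (cheb_pair x n) \<le> 2 * norm x * norm (cheb_pair x (Suc (Suc m))) + norm (cheb_pair x (Suc m))"
      unfolding 4 cheb_pair_rec by (rule order_trans[OF norm_triangle_ineq4]) (simp add: norm_mult)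
    also have "\<dots> \<le> 2 * norm x * (2 * M ^ Suc (Suc m)) + 2 * M ^ Suc m"
      using less.IH[of "Suc (Suc m)"] less.IH[of "Suc m"]
      by (intro add_mono mult_left_mono) (auto simp: 4 M_def)
    also have "\<dots> \<le> 2 * norm x * (2 * M ^ Suc (Suc m)) + 2 * M ^ Suc (Suc m)"
      using M by (intro add_mono mult_left_mono power_increasing) auto
    also have "\<dots> = 2 * M ^ n"
      by (simp add: 4 M_def algebra_simps)
    finally show ?thesis by (simp add: M_def)
  next
    case 3
    have "norm (cheb_pair x n) \<le> norm (2 * x * (2 * x)) + norm (2 :: complex)"
      unfolding 3 numeral_2_eq_2 cheb_pair_2 cheb_pair_1 by (rule norm_triangle_ineq4)
    also have "\<dots> \<le> 2 * (2 * norm x + 1) ^ n"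
      by (simp add: 3 norm_mult power2_eq_square algebra_simps)
    finally show ?thesis .
  qed (simp_all add: cheb_pair_0 cheb_pair_1 norm_mult)
qed

lemma summable_norm_cheb_pair:
  assumes q: "norm q < 1" and c: "c \<ge> 1"
  shows "summable (\<lambda>r. norm (q ^ (c * r\<^sup>2) * cheb_pair x r))"
proof -
  define M where "M = 2 * norm x + 1"
  have M: "M \<ge> 0" by (simp add: M_def)
  \<comment> \<open>The quadratic exponent wins: \<open>|q|^(r^2) M^r = (M |q|^r)^r\<close>, whose
    base is eventually below 1/2.\<close>
  have "(\<lambda>r. M * norm q ^ r) \<longlonglongrightarrow> M * 0"
    using q by (intro tendsto_intros LIMSEQ_power_zero) auto
  then have "\<forall>\<^sub>F r in sequentially. M * norm q ^ r < 1 / 2"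
    by (rule order_tendstoD) auto
  then have "\<forall>\<^sub>F r in sequentially. norm (norm (q ^ (c * r\<^sup>2) * cheb_pair x r)) \<le> 2 * (1 / 2) ^ r"
  proof eventually_elim
    case (elim r)
    have "r * r \<le> c * r\<^sup>2"
      using mult_le_mono1[OF c, of "r * r"] by (simp add: power2_eq_square)
    then have "norm q ^ (c * r\<^sup>2) \<le> norm q ^ (r * r)"
      using q by (intro power_decreasing) auto
    then have "norm (q ^ (c * r\<^sup>2) * cheb_pair x r) \<le> norm q ^ (r * r) * (2 * M ^ r)"
      unfolding norm_mult norm_power M_def by (intro mult_mono norm_cheb_pair_le) auto
    also have "\<dots> = 2 * (M * norm q ^ r) ^ r"
      by (simp add: power_mult power_mult_distrib)
    also have "\<dots> \<le> 2 * (1 / 2) ^ r"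
      using elim M by (intro mult_left_mono power_mono) auto
    finally show ?case by simp
  qed
  then show ?thesis
    by (rule summable_comparison_test_ev) (intro summable_mult summable_geometric, simp)
qed

section \<open>Multi-indices grouped by their largest entry\<close>

definition index_fibre :: "nat \<Rightarrow> nat \<Rightarrow> (nat \<Rightarrow> nat) set" where
  "index_fibre k N = {n \<in> multi_indices k. n k = N}"

lemma index_fibre_1: "index_fibre (Suc 0) N = {\<lambda>i\<in>{Suc 0}. N}"
proof -
  have "n = (\<lambda>i\<in>{Suc 0}. N)" if "n \<in> index_fibre (Suc 0) N" for n
  proof
    show "n i = (\<lambda>i\<in>{Suc 0}. N) i" for i
      using that by (cases "i = Suc 0") (auto simp: index_fibre_def multi_indices_def PiE_iff extensional_def)
  qed
  moreover have "(\<lambda>i\<in>{Suc 0}. N) \<in> index_fibre (Suc 0) N"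
    by (simp add: index_fibre_def multi_indices_def)
  ultimately show ?thesis by blast
qed

text \<open>Removing the last entry \<open>N\<close> leaves a shorter tuple whose own last entry
  \<open>r\<close> is at most \<open>N\<close>.\<close>

lemma index_fibre_Suc:
  assumes "k \<ge> 1"
  shows "index_fibre (Suc k) N = (\<lambda>(r, n). n(Suc k := N)) ` (SIGMA r:{..N}. index_fibre k r)"
proof (intro subset_antisym subsetI)
  fix n assume n: "n \<in> index_fibre (Suc k) N"
  \<comment> \<open>Resetting the entry to \<open>undefined\<close> makes the function extensional
    on \<open>{1..k}\<close>.\<close>
  define m where "m = n(Suc k := undefined)"
  have "m \<in> index_fibre k (n k)"
    using n by (auto simp: m_def index_fibre_def multi_indices_def PiE_iff extensional_def)
  moreover have "n k \<le> N"
    using n assms by (auto simp: index_fibre_def multi_indices_def)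
  moreover have "n = m(Suc k := N)"
    using n by (auto simp: m_def index_fibre_def)
  ultimately show "n \<in> (\<lambda>(r, n). n(Suc k := N)) ` (SIGMA r:{..N}. index_fibre k r)"
    by (intro image_eqI[of _ _ "(n k, m)"]) auto
next
  fix n assume "n \<in> (\<lambda>(r, n). n(Suc k := N)) ` (SIGMA r:{..N}. index_fibre k r)"
  then obtain m where m: "n = m(Suc k := N)" "m \<in> multi_indices k" "m k \<le> N"
    by (auto simp: index_fibre_def)
  have "n j \<le> n (j + 1)" if "j \<in> {1..<Suc k}" for j
    using that m by (cases "j = k") (auto simp: multi_indices_def)
  then show "n \<in> index_fibre (Suc k) N"
    using m by (auto simp: index_fibre_def multi_indices_def PiE_iff extensional_def)
qed

lemma inj_on_index_fibre_Suc:
  "inj_on (\<lambda>(r, n). n(Suc k := N)) (SIGMA r:{..N}. index_fibre k r)"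
proof (rule inj_onI, clarify)
  fix r n r' n'
  assume n: "n \<in> index_fibre k r" "n' \<in> index_fibre k r'" and eq: "n(Suc k := N) = n'(Suc k := N)"
  \<comment> \<open>The overwritten entry held no information, so \<open>n\<close> is recovered from
    its update, and \<open>r\<close> is \<open>n k\<close>.\<close>
  have "n (Suc k) = undefined" "n' (Suc k) = undefined"
    using n by (auto simp: index_fibre_def multi_indices_def PiE_iff extensional_def)
  then have "n = n'"
    using eq by (metis fun_upd_triv fun_upd_upd)
  then show "r = r' \<and> n = n'"
    using n by (auto simp: index_fibre_def)
qed

lemma multisum_term_fun_upd:
  assumes "k \<ge> 1" "n \<in> index_fibre k r"
  shows "multisum_term (Suc k) q x (n(Suc k := N))
    = (q\<^sup>2) ^ N\<^sup>2 * multisum_term k q x n * inv_qpoch (q\<^sup>2) (N - r)"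
proof -
  define n' where "n' = n(Suc k := N)"
  have n': "n' 1 = n 1" "n' (Suc k) = N" "n' k = r"
    using assms by (auto simp: n'_def index_fibre_def)
  have s: "(\<Sum>j=1..k. (n' j)\<^sup>2) = (\<Sum>j=1..k. (n j)\<^sup>2)"
    by (intro sum.cong) (auto simp: n'_def)
  have p: "(\<Prod>j=1..<k. qpoch (q\<^sup>2) (q\<^sup>2) (n' (j + 1) - n' j)) = (\<Prod>j=1..<k. qpoch (q\<^sup>2) (q\<^sup>2) (n (j + 1) - n j))"
    by (intro prod.cong) (auto simp: n'_def)
  have p': "(\<Prod>j=1..<Suc k. qpoch (q\<^sup>2) (q\<^sup>2) (n' (j + 1) - n' j))
      = (\<Prod>j=1..<k. qpoch (q\<^sup>2) (q\<^sup>2) (n (j + 1) - n j)) * qpoch (q\<^sup>2) (q\<^sup>2) (N - r)"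
    using assms(1) p n' by (simp add: prod.atLeastLessThan_Suc)
  have e: "q ^ (2 * (\<Sum>j=1..Suc k. (n' j)\<^sup>2)) = (q\<^sup>2) ^ N\<^sup>2 * q ^ (2 * (\<Sum>j=1..k. (n j)\<^sup>2))"
    using s by (simp add: n' power_add power_mult algebra_simps)
  show ?thesis
    unfolding n'_def[symmetric] multisum_term_def p' e n' inv_qpoch_def
    by (simp add: field_simps)
qed

text \<open>By \<open>multisum_term_fun_upd\<close>, appending an entry matches one step of
  \<open>iter_beta\<close>, so the fibre sums obey its recursion. Finiteness joins the induction to
  justify the nested sums.\<close>

lemma sum_index_fibre:
  "finite (index_fibre (Suc m) N) \<and>
   (\<Sum>n\<in>index_fibre (Suc m) N. multisum_term (Suc m) q x n) = (q\<^sup>2) ^ N\<^sup>2 * iter_beta q x m N"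
proof (induction m arbitrary: N)
  case 0
  show ?case
    by (simp add: index_fibre_1 multisum_term_def inv_qpoch_def field_simps flip: power_mult)
next
  case (Suc m)
  have fin: "finite (index_fibre (Suc m) r)" for r
    using Suc.IH by blast
  have "(\<Sum>n\<in>index_fibre (Suc (Suc m)) N. multisum_term (Suc (Suc m)) q x n)
      = (\<Sum>(r, n)\<in>(SIGMA r:{..N}. index_fibre (Suc m) r).
           multisum_term (Suc (Suc m)) q x (n(Suc (Suc m) := N)))"
    by (subst index_fibre_Suc, simp, subst sum.reindex[OF inj_on_index_fibre_Suc])
       (simp add: case_prod_unfold o_def)
  also have "\<dots> = (\<Sum>r\<le>N. \<Sum>n\<in>index_fibre (Suc m) r.
      (q\<^sup>2) ^ N\<^sup>2 * multisum_term (Suc m) q x n * inv_qpoch (q\<^sup>2) (N - r))"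
    by (subst sum.Sigma[symmetric]) (auto intro!: sum.cong simp: fin multisum_term_fun_upd)
  also have "\<dots> = (q\<^sup>2) ^ N\<^sup>2 * iter_beta q x (Suc m) N"
    using Suc.IH by (simp add: sum_distrib_left[symmetric] sum_distrib_right[symmetric] mult.assoc)
  finally show ?case
    using fin by (auto simp: index_fibre_Suc)
qed

section \<open>Absolute convergence of the multisum\<close>

lemma summable_on_prod_PiE_nonneg:
  fixes f :: "nat \<Rightarrow> real"
  assumes A: "finite A" and f: "summable f" "\<And>i. f i \<ge> 0"
  shows "(\<lambda>n. \<Prod>a\<in>A. f (n a)) summable_on (A \<rightarrow>\<^sub>E UNIV)"
proof (rule nonneg_bdd_above_summable_on)
  show "(\<Prod>a\<in>A. f (n a)) \<ge> 0" for n
    by (intro prod_nonneg) (auto simp: f)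
  show "bdd_above (sum (\<lambda>n. \<Prod>a\<in>A. f (n a)) ` {F. F \<subseteq> A \<rightarrow>\<^sub>E UNIV \<and> finite F})"
  proof (rule bdd_aboveI2)
    fix F assume F: "F \<in> {F. F \<subseteq> A \<rightarrow>\<^sub>E (UNIV :: nat set) \<and> finite F}"
    \<comment> \<open>A finite set of tuples lies in a box with side \<open>{..M}\<close>, over
      which the sum factors into partial sums of \<open>f\<close>.\<close>
    define M where "M = Max ((\<lambda>(n, a). n a) ` (F \<times> A))"
    have "n a \<le> M" if "n \<in> F" "a \<in> A" for n a
      unfolding M_def using F A that by (intro Max_ge) (auto intro!: image_eqI[of _ _ "(n, a)"])
    then have sub: "F \<subseteq> A \<rightarrow>\<^sub>E {..M}"
      using F by (auto simp: PiE_iff)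
    have "(\<Sum>n\<in>F. \<Prod>a\<in>A. f (n a)) \<le> (\<Sum>n\<in>A \<rightarrow>\<^sub>E {..M}. \<Prod>a\<in>A. f (n a))"
      using sub A by (intro sum_mono2 finite_PiE prod_nonneg) (auto simp: f)
    also have "\<dots> = (\<Prod>a\<in>A. \<Sum>i\<le>M. f i)"
      using A by (intro prod_sum_PiE[symmetric]) auto
    also have "\<dots> \<le> (\<Prod>a\<in>A. suminf f)"
      by (intro prod_mono conjI sum_nonneg sum_le_suminf) (auto simp: f)
    finally show "(\<Sum>n\<in>F. \<Prod>a\<in>A. f (n a)) \<le> (\<Prod>a\<in>A. suminf f)" .
  qed
qed

text \<open>The finite products and reciprocals are uniformly bounded, and
  \<open>n_j^2 \<ge> n_j\<close>. This gives a product of geometric terms as majorant, summable even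
  over all tuples, monotone or not.\<close>

lemma multisum_abs_summable:
  assumes q: "norm q < 1"
  shows "(\<lambda>n. norm (multisum_term k q x n)) summable_on multi_indices k"
proof -
  define Q where "Q = q\<^sup>2"
  have Q: "norm Q < 1"
    using q by (simp add: Q_def norm_power power_less_one_iff)
  obtain C where C: "C \<ge> 1" "\<And>n. norm (inv_qpoch Q n) \<le> C"
    using inv_qpoch_bounded[OF Q] by blast
  obtain P where P: "P \<ge> 0" "\<And>n. norm (\<Prod>j=1..n. 1 + 2 * x * q ^ (2 * j - 1) + q ^ (4 * j - 2)) \<le> P"
    using quadratic_prod_bounded[OF q] by blast
  define D where "D = P * ((\<Prod>j=1..<k. C) * C)"
  have bound: "norm (multisum_term k q x n) \<le> D * (\<Prod>j=1..k. norm Q ^ n j)" for n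
  proof -
    have "multisum_term k q x n = q ^ (2 * (\<Sum>j=1..k. (n j)\<^sup>2)) *
     (\<Prod>j=1..n 1. 1 + 2 * x * q ^ (2 * j - 1) + q ^ (4 * j - 2)) *
     ((\<Prod>j=1..<k. inv_qpoch Q (n (j + 1) - n j)) * inv_qpoch Q (2 * n 1))"
      by (simp add: multisum_term_def Q_def inv_qpoch_def divide_inverse prod_inversef[unfolded o_def])
    moreover have "norm (q ^ (2 * (\<Sum>j=1..k. (n j)\<^sup>2))) \<le> (\<Prod>j=1..k. norm Q ^ n j)"
    proof -
      have "norm (q ^ (2 * (\<Sum>j=1..k. (n j)\<^sup>2))) = (\<Prod>j=1..k. norm Q ^ (n j)\<^sup>2)"
        by (simp add: Q_def norm_power power_mult power_sum flip: prod_norm)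
      also have "\<dots> \<le> (\<Prod>j=1..k. norm Q ^ n j)"
        using Q by (intro prod_mono conjI power_decreasing) (auto simp: power2_eq_square)
      finally show ?thesis .
    qed
    moreover have "norm (\<Prod>j=1..<k. inv_qpoch Q (n (j + 1) - n j)) \<le> (\<Prod>j=1..<k. C)"
      unfolding prod_norm[symmetric] by (intro prod_mono) (auto simp: C)
    ultimately have "norm (multisum_term k q x n) \<le> (\<Prod>j=1..k. norm Q ^ n j) * P * ((\<Prod>j=1..<k. C) * C)"
      using C P by (auto simp only: norm_mult intro!: mult_mono mult_nonneg_nonneg prod_nonneg norm_ge_zero zero_le_power)
    then show ?thesis
      by (simp add: D_def mult_ac)
  qed
  have "(\<lambda>n. D * (\<Prod>j=1..k. norm Q ^ n j)) summable_on ({1..k} \<rightarrow>\<^sub>E UNIV)"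
    using Q by (intro summable_on_cmult_right summable_on_prod_PiE_nonneg summable_geometric) auto
  then have "(\<lambda>n. D * (\<Prod>j=1..k. norm Q ^ n j)) summable_on multi_indices k"
    by (rule summable_on_subset_banach) (auto simp: multi_indices_def)
  then show ?thesis
    by (rule summable_on_comparison_test) (use bound in auto)
qed

section \<open>Summation over the fibres and the limit of the chain\<close>

theorem theorem4p5:
  fixes q x :: complex and k :: nat
  assumes "norm q < 1" and "k \<ge> 1"
  shows "summable (\<lambda>n. q ^ ((2 * k + 1) * n\<^sup>2) * (cheb_V (int n) x + cheb_V (int n - 1) x)) \<and>
    multisum_term k q x summable_on multi_indices k \<and>
    1 / qpoch_inf (q\<^sup>2) (q\<^sup>2) *
      (\<Sum>n. q ^ ((2 * k + 1) * n\<^sup>2) * (cheb_V (int n) x + cheb_V (int n - 1) x))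
    = (\<Sum>\<^sub>\<infinity>n\<in>multi_indices k. multisum_term k q x n)"
proof -
  have Q: "norm (q\<^sup>2) < 1"
    using assms by (simp add: norm_power power_less_one_iff)
  \<comment> \<open>\<open>iter_beta\<close> performs \<open>m = k - 1\<close> steps; the last one
    takes place in \<open>bailey_pair_limit\<close>.\<close>
  obtain m where k: "k = Suc m"
    using assms(2) by (cases k) auto
  define T where "T = multisum_term k q x"
  have bij: "bij_betw snd (SIGMA N:UNIV. index_fibre k N) (multi_indices k)"
    by (rule bij_betw_byWitness[where f' = "\<lambda>n. (n k, n)"]) (auto simp: index_fibre_def)
  have T: "T summable_on multi_indices k"
    unfolding T_def by (rule abs_summable_summable[OF multisum_abs_summable[OF assms(1)]])
  then have T_Sigma: "(\<lambda>(N, n). T n) summable_on (SIGMA N:UNIV. index_fibre k N)"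
    using summable_on_reindex_bij_betw[OF bij, of T] by (simp add: case_prod_unfold)
  have fibre: "infsum T (index_fibre k N) = (q\<^sup>2) ^ N\<^sup>2 * iter_beta q x m N" for N
    using sum_index_fibre[of m N q x] by (simp add: T_def k)
  have \<beta>: "(\<lambda>N. (q\<^sup>2) ^ N\<^sup>2 * iter_beta q x m N) summable_on UNIV"
    using summable_on_Sigma_banach[OF T_Sigma] by (simp add: fibre)
  have "infsum T (multi_indices k) = (\<Sum>\<^sub>\<infinity>N. infsum T (index_fibre k N))"
    using infsum_Sigma'_banach[OF T_Sigma] infsum_reindex_bij_betw[OF bij, of T] by (simp add: case_prod_unfold)
  also have "\<dots> = (\<Sum>N. (q\<^sup>2) ^ N\<^sup>2 * iter_beta q x m N)"
    unfolding fibre using has_sum_imp_sums[OF has_sum_infsum[OF \<beta>]] by (simp add: sums_iff)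
  finally have RHS: "infsum T (multi_indices k) = (\<Sum>N. (q\<^sup>2) ^ N\<^sup>2 * iter_beta q x m N)" .
  have \<alpha>: "summable (\<lambda>r. norm (q ^ ((2 * k + 1) * r\<^sup>2) * cheb_pair x r))"
    by (rule summable_norm_cheb_pair) (use assms in auto)
  \<comment> \<open>For complex families unconditional summability already implies absolute
    summability.\<close>
  have "summable (\<lambda>N. norm ((q\<^sup>2) ^ N\<^sup>2 * iter_beta q x m N))"
    using \<beta> by (intro summable_on_imp_summable) (simp add: summable_on_iff_abs_summable_on_complex)
  then have "1 / qpoch_inf (q\<^sup>2) (q\<^sup>2) * (\<Sum>r. q ^ ((2 * k + 1) * r\<^sup>2) * cheb_pair x r) = infsum T (multi_indices k)"
    unfolding RHS using bailey_pair_limit[OF Q bailey_pair_iter[OF assms(1)]] \<alpha>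
    unfolding iter_alpha_step k by blast
  then show ?thesis
    using T summable_norm_cancel[OF \<alpha>] by (simp add: T_def cheb_pair_def)
qed

end
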